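(* Let $n\ge 1$, let $(S_i,\mathbb{S}_i)$, $i=1,\ldots,n$, be measurable spaces, $S=\prod_{i=1}^n S_i$, $\mathbb{S}=\bigotimes_{i=1}^n\mathbb{S}_i$, let $\mathbf{X}=(X_1,\ldots,X_n)\in S$ be a random vector with distribution $P$, any probability measure on $(S,\mathbb{S})$ such that $X_1,\ldots,X_n$ are independent, and let $\mathbf{Y}$ be an independent copy of $\mathbf{X}$. Framework I. Let $\mathcal{A},\mathcal{B}$ be finite or countable index sets, and let $\{f_\alpha\}_{\alpha\in\mathcal{A}}$, $\{g_\beta\}_{\beta\in\mathcal{B}}$ be collections of non-negative real-valued $\mathbb{S}$-measurable functions on $S$ such that $f_\alpha$ depends on $K_\alpha\subseteq\mathbf{n}$ and $g_\beta$ depends on $L_\beta\subseteq\mathbf{n}$; put $\mathcal{K}=\{K_\alpha\}_{\alpha\in\mathcal{A}}$ and $\mathcal{L}=\{L_\beta\}_{\beta\in\mathcal{B}}$. Then: (c$'$) $$E\Big\{\max_{K\in\mathcal{K},\,L\in\mathcal{L}:\ K\cap L=\emptyset}\tilde f_K(\mathbf{X})\,\tilde g_L(\mathbf{Y})\Big\}\le E\Big\{\sup_{\alpha\in\mathcal A,\,\beta\in\mathcal B} f_\alpha(\mathbf{X})g_\beta(\mathbf{X})\Big\};$$ (d$'$) for any given measurable functions $K(\mathbf{x},\mathbf{y})\in\mathcal{K}$ and $L(\mathbf{x},\mathbf{y})\in\mathcal{L}$ on $S\times S$ such that $K(\mathbf{x},\mathbf{y})\cap L(\mathbf{x},\mathbf{y})=\emptyset$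 for all $\mathbf{x},\mathbf{y}\in S$, $$E\big\{\tilde f_{K(\mathbf{X},\mathbf{Y})}(\mathbf{X})\,\tilde g_{L(\mathbf{X},\mathbf{Y})}(\mathbf{Y})\big\}\le E\Big\{\sup_{\alpha\in\mathcal A,\,\beta\in\mathcal B} f_\alpha(\mathbf{X})g_\beta(\mathbf{X})\Big\}.$$ Framework II. Let $f,g$ be non-negative real-valued $\mathbb{S}$-measurable functions on $S$ and let $\mathcal{K},\mathcal{L}\subseteq 2^{\mathbf{n}}$ be any collections of subsets of $\mathbf{n}$. Then: (e$'$) for any given measurable functions $K(\mathbf{x},\mathbf{y})\in\mathcal{K}$ and $L(\mathbf{x},\mathbf{y})\in\mathcal{L}$ on $S\times S$ such that $K(\mathbf{x},\mathbf{y})\cap L(\mathbf{x},\mathbf{y})=\emptyset$ for all $\mathbf{x},\mathbf{y}\in S$, $$E\big\{\underline{f}_{K(\mathbf{X},\mathbf{Y})}(\mathbf{X})\,\underline{g}_{L(\mathbf{X},\mathbf{Y})}(\mathbf{Y})\big\}\le E\{f(\mathbf{X})g(\mathbf{X})\}.$$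
   Context: $\mathbf{n}=\{1,\ldots,n\}$. For $\mathbf{x}\in S$ and $K\subseteq\mathbf{n}$, $\mathbf{x}_K$ is the restriction of $\mathbf{x}$ to the coordinates in $K$, and $[\mathbf{x}]_K=\{\mathbf{y}\in S:\mathbf{y}_K=\mathbf{x}_K\}$. A function $f$ on $S$ depends on $K$ if $\mathbf{x}_K=\mathbf{y}_K$ implies $f(\mathbf{x})=f(\mathbf{y})$. The sets $K_\alpha$ (and likewise the $L_\beta$) need not be distinct. Functions on $S\times S$ with values in $2^{\mathbf{n}}$ are measurable with respect to $\mathbb{S}\otimes\mathbb{S}$ and the discrete sigma algebra on $2^{\mathbf{n}}$. In Framework I, for $K,L\subseteq\mathbf{n}$, $$\tilde f_K(\mathbf{x})=\sup_{\alpha:\,K_\alpha\subseteq K}f_\alpha(\mathbf{x}),\qquad \tilde g_L(\mathbf{x})=\sup_{\beta:\,L_\beta\subseteq L}g_\beta(\mathbf{x}),$$ and $\tilde f_{K(\mathbf{x},\mathbf{y})}(\mathbf{x})=\sup_{\alpha:\,K_\alpha\subseteq K(\mathbf{x},\mathbf{y})}f_\alpha(\mathbf{x})$, $\tilde g_{L(\mathbf{x},\mathbf{y})}(\mathbf{y})=\sup_{\beta:\,L_\beta\subseteq L(\mathbf{x},\mathbf{y})}g_\beta(\mathbf{y})$. In Framework II, for $K\subseteq\mathbf{n}$, $\underline{f}_K(\mathbf{x})=\operatorname{ess\,inf}_{\mathbf{z}\in[\mathbf{x}]_K}f(\mathbf{z})$, where the essential infimum is taken over the coordinates of $\mathbf{z}$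 in $K^c$, with respect to the marginal $P_{K^c}$ of $P$ on those coordinates (the coordinates in $K$ being fixed equal to $\mathbf{x}_K$); $\underline{g}_L$ is defined in the same way; for $K=\mathbf{n}$, $\underline f_K=f$. The quantity $\underline{f}_{K(\mathbf{x},\mathbf{y})}(\mathbf{x})$ is $\underline{f}_K(\mathbf{x})$ evaluated at $K=K(\mathbf{x},\mathbf{y})$, and $\underline{g}_{L(\mathbf{x},\mathbf{y})}(\mathbf{y})$ is $\underline{g}_L(\mathbf{y})$ evaluated at $L=L(\mathbf{x},\mathbf{y})$. Expectations take values in $[0,\infty]$, $0\cdot\infty=0$, and the supremum (maximum) of an empty collection of non-negative quantities is $0$. *)

theory Defs
  imports "HOL-Probability.Probability"
begin

definition depends_on :: "(nat \<Rightarrow> 'a) measure \<Rightarrow> ((nat \<Rightarrow> 'a) \<Rightarrow> 'b) \<Rightarrow> nat set \<Rightarrow> bool" where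
  "depends_on S f K \<longleftrightarrow>
     (\<forall>x\<in>space S. \<forall>y\<in>space S. restrict x K = restrict y K \<longrightarrow> f x = f y)"

text \<open>The supremum may be infinite, hence the type \<^typ>\<open>ennreal\<close>; there the supremum
  of the empty set is 0.\<close>

definition sup_within ::
  "'i set \<Rightarrow> ('i \<Rightarrow> nat set) \<Rightarrow> ('i \<Rightarrow> (nat \<Rightarrow> 'a) \<Rightarrow> real) \<Rightarrow> nat set \<Rightarrow> (nat \<Rightarrow> 'a) \<Rightarrow> ennreal" where
  "sup_within A Ka f K x = (SUP \<alpha>\<in>{\<alpha>\<in>A. Ka \<alpha> \<subseteq> K}. ennreal (f \<alpha> x))"

definition ess_inf :: "'a measure \<Rightarrow> ('a \<Rightarrow> 'b::complete_linorder) \<Rightarrow> 'b" where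
  "ess_inf N h = Sup {c. AE z in N. c \<le> h z}"

definition marginal ::
  "(nat \<Rightarrow> 'a measure) \<Rightarrow> (nat \<Rightarrow> 'a) measure \<Rightarrow> nat set \<Rightarrow> (nat \<Rightarrow> 'a) measure" where
  "marginal M P J = distr P (PiM J M) (\<lambda>z. restrict z J)"

text \<open>The essential infimum of \<open>f\<close> over the points that agree with \<open>x\<close> on \<open>K\<close>: the variable
  \<open>w\<close> ranges over the coordinates in the complement of \<open>K\<close>.\<close>

definition ess_inf_fix ::
  "nat \<Rightarrow> (nat \<Rightarrow> 'a measure) \<Rightarrow> (nat \<Rightarrow> 'a) measure \<Rightarrow> ((nat \<Rightarrow> 'a) \<Rightarrow> real)
    \<Rightarrow> nat set \<Rightarrow> (nat \<Rightarrow> 'a) \<Rightarrow> ennreal" where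
  "ess_inf_fix n M P f K x =
     ess_inf (marginal M P ({1..n} - K))
       (\<lambda>w. ennreal (f (merge K ({1..n} - K) (x, w))))"

lemma ess_inf_fix_full:
  assumes P: "prob_space P" and sets: "sets P = sets (PiM {1..n} M)"
    and x: "x \<in> space (PiM {1..n} M)"
  shows "ess_inf_fix n M P f {1..n} x = ennreal (f x)"
proof -
  have "(\<lambda>z. restrict z {}) \<in> measurable P (PiM {} M)"
    unfolding measurable_cong_sets[OF sets refl] by (rule measurable_restrict_subset) simp
  then interpret Q: prob_space "marginal M P {}"
    unfolding marginal_def by (rule prob_space.prob_space_distr[OF P])
  have m: "merge {1..n} {} (x, w) = x" for w
    using x by (auto simp: merge_def space_PiM PiE_def extensional_def)
  show ?thesis
    unfolding ess_inf_fix_def ess_inf_def Diff_cancel m Q.AE_const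
    by (rule cSup_eq_maximum) auto
qed

end

theory Submission
  imports Defs
begin

text \<open>
  Symmetrise, and then prove an inequality on the discrete cube. Write \<open>I = {1..n}\<close>. Since
  the coordinates are independent, the law of an independent pair \<open>(x, y)\<close> does not change when
  the coordinates in a fixed \<open>Z \<subseteq> I\<close> are exchanged between \<open>x\<close> and \<open>y\<close>. It is therefore enough
  to compare, for almost every fixed pair, the sums of both sides over all \<open>Z\<close>
  (\<open>dual_reimer_integral\<close>). For a fixed pair the first points of the exchanged pairs are
  indexed by \<open>Pow I\<close>, a discrete cube, and the second point of the pair for \<open>Z\<close> is the
  first point of the pair for the antipode \<open>I - Z\<close>.

  On the cube, the claim for indicator functions is Reimer's theorem: if each \<open>z \<in> D\<close> has disjoint
  sets \<open>K z\<close>, \<open>L z\<close> such that agreeing with \<open>z\<close> on \<open>K z\<close> forces membership in \<open>A\<close>, and agreeing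
  with the antipode of \<open>z\<close> on \<open>L z\<close> forces membership in \<open>B\<close>, then \<open>A \<inter> B\<close> has at least \<open>card D\<close> points
  (\<open>reimer_cube\<close>). Its proof is linear algebra. To each \<open>z \<in> D\<close> and to each \<open>z \<notin> A \<inter> B\<close>
  one attaches an integer vector indexed by the cube, a tensor product of vectors of the
  plane. The vectors of the first kind are orthogonal to those of the second kind; both
  families are linearly independent, because their Gram matrices against suitable test vectors
  are diagonal and invertible, modulo 2 for the first family and modulo 3 for the second. Hence
  \<open>card D + card (Pow I - A \<inter> B) \<le> 2 ^ card I\<close>. Layer-cake integration turns the statement
  about sets into one about functions (\<open>functional_reimer_cube\<close>).

  All three inequalities use this with a family \<open>\<phi> K\<close> such that \<open>\<phi> K\<close> depends only on the
  coordinates in \<open>K\<close> and \<open>\<phi> K \<le> F\<close> almost everywhere, and a similar family \<open>\<gamma> L \<le> G\<close>.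
  In Framework I these are the suprema over indices with \<open>K\<^sub>\<alpha> \<subseteq> K\<close>, and \<open>F\<close>, \<open>G\<close> are the
  unrestricted suprema, whose product is the supremum of the products. In Framework II they are
  the essential infima over the coordinates outside \<open>K\<close>; here \<open>\<phi> K \<le> F\<close> almost everywhere is Fubini's
  theorem.
\<close>

section \<open>Linear relations over the integers\<close>

text \<open>Gaussian elimination without division: pick an unknown with non-zero coefficient in
  the first equation, cross-multiply to remove it from the other equations, and solve for it at
  the end up to the factor \<open>a e u0\<close>. Staying in the ring matters because the
  independence criterion below uses divisibility of the coefficients.\<close>

lemma exists_nontrivial_relation:
  fixes a :: "'e \<Rightarrow> 'u \<Rightarrow> 'r::idom"
  assumes "finite E" "finite U" "card E < card U"
  shows "\<exists>c. (\<exists>u\<in>U. c u \<noteq> 0) \<and> (\<forall>e\<in>E. (\<Sum>u\<in>U. c u * a e u) = 0)"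
  using assms
proof (induction E arbitrary: U a rule: finite_induct)
  case empty
  then have "U \<noteq> {}" by auto
  then show ?case by (intro exI[of _ "\<lambda>_. 1"]) auto
next
  case (insert e E)
  show ?case
  proof (cases "\<forall>u\<in>U. a e u = 0")
    case True
    have "card E < card U" using insert by auto
    from insert.IH[OF insert.prems(1) this, of a] True show ?thesis by auto
  next
    case False
    then obtain u0 where u0: "u0 \<in> U" "a e u0 \<noteq> 0" by auto
    let ?b = "\<lambda>e' u. a e u0 * a e' u - a e' u0 * a e u"
    have "card E < card (U - {u0})" using insert u0 by auto
    from insert.IH[OF _ this, of ?b] insert.prems obtain c where
      c: "\<exists>u\<in>U - {u0}. c u \<noteq> 0" and eq: "\<forall>e'\<in>E. (\<Sum>u\<in>U - {u0}. c u * ?b e' u) = 0" by auto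
    let ?d = "\<lambda>u. if u = u0 then - (\<Sum>v\<in>U - {u0}. c v * a e v) else a e u0 * c u"
    have split: "(\<Sum>u\<in>U. ?d u * a e' u) = (\<Sum>u\<in>U - {u0}. c u * ?b e' u)" for e'
    proof -
      have "(\<Sum>u\<in>U. ?d u * a e' u) = ?d u0 * a e' u0 + (\<Sum>u\<in>U - {u0}. ?d u * a e' u)"
        using insert.prems u0 by (subst sum.remove[of _ u0]) auto
      also have "\<dots> = - (\<Sum>v\<in>U - {u0}. c v * a e v) * a e' u0
          + (\<Sum>u\<in>U - {u0}. a e u0 * c u * a e' u)" by (auto intro!: sum.cong)
      also have "\<dots> = (\<Sum>u\<in>U - {u0}. c u * ?b e' u)"
        by (simp add: sum_distrib_left sum_distrib_right sum_subtractf algebra_simps)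
      finally show ?thesis .
    qed
    from c u0 have "\<exists>u\<in>U. ?d u \<noteq> 0" by auto
    moreover have "\<forall>e'\<in>insert e E. (\<Sum>u\<in>U. ?d u * a e' u) = 0"
      unfolding split using eq by (auto simp: mult.commute)
    ultimately show ?thesis by (intro exI[of _ ?d]) auto
  qed
qed

text \<open>Infinite descent: modulo \<open>p\<close> the relations read \<open>c x * a x x = 0\<close> with \<open>a x x\<close> invertible, so \<open>p\<close>
  divides every coefficient of a relation. Dividing by \<open>p\<close> gives another relation, so every
  power of \<open>p\<close> divides every coefficient.\<close>

lemma independent_if_diagonal_mod_prime:
  fixes a :: "'z \<Rightarrow> 'z \<Rightarrow> int" and p :: int
  assumes p: "prime p" and U: "finite U"
    and eq: "\<And>x. x \<in> U \<Longrightarrow> (\<Sum>z\<in>U. c z * a z x) = 0"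
    and off: "\<And>z x. z \<in> U \<Longrightarrow> x \<in> U \<Longrightarrow> z \<noteq> x \<Longrightarrow> p dvd a z x"
    and diag: "\<And>x. x \<in> U \<Longrightarrow> \<not> p dvd a x x"
    and x: "x \<in> U"
  shows "c x = 0"
proof -
  have pow: "\<forall>z\<in>U. p ^ k dvd c z" for k
  proof (induction k)
    case (Suc k)
    have ck: "c z = p ^ k * (c z div p ^ k)" if "z \<in> U" for z using Suc that by simp
    have "p ^ Suc k dvd c y" if y: "y \<in> U" for y
    proof -
      let ?d = "\<lambda>z. c z div p ^ k"
      have "p ^ k * (\<Sum>z\<in>U. ?d z * a z y) = (\<Sum>z\<in>U. c z * a z y)"
        unfolding sum_distrib_left using ck by (intro sum.cong) (auto simp flip: mult.assoc)
      then have "(\<Sum>z\<in>U. ?d z * a z y) = 0" using eq[OF y] p by auto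
      then have "?d y * a y y = - (\<Sum>z\<in>U - {y}. ?d z * a z y)"
        using U y by (subst (asm) sum.remove[of _ y]) auto
      moreover have "p dvd (\<Sum>z\<in>U - {y}. ?d z * a z y)"
        by (intro dvd_sum dvd_mult) (use y off in auto)
      ultimately have "p dvd ?d y * a y y" by simp
      then have "p dvd ?d y" using diag[OF y] p by (simp add: prime_dvd_mult_iff)
      then have "p ^ k * p dvd p ^ k * ?d y" by (rule mult_dvd_mono[OF dvd_refl])
      then show ?thesis using ck[OF y] by (simp add: mult.commute)
    qed
    then show ?case by blast
  qed simp
  show ?thesis
  proof (rule ccontr)
    assume nz: "c x \<noteq> 0"
    have p2: "p \<ge> 2" using p by (simp add: prime_ge_2_int)
    have "p ^ nat \<bar>c x\<bar> dvd c x" using pow x by blast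
    then have "\<bar>p ^ nat \<bar>c x\<bar>\<bar> \<le> \<bar>c x\<bar>" using nz dvd_imp_le_int by blast
    then have "p ^ nat \<bar>c x\<bar> \<le> \<bar>c x\<bar>" using p2 by simp
    moreover have "(2::int) ^ nat \<bar>c x\<bar> \<le> p ^ nat \<bar>c x\<bar>" using p2 by (intro power_mono) auto
    moreover have "int (nat \<bar>c x\<bar>) < 2 ^ nat \<bar>c x\<bar>"
      by (rule of_nat_less_two_power)
    ultimately show False by linarith
  qed
qed

section \<open>Reimer's theorem on the discrete cube\<close>

lemma sum_Pow_prod:
  fixes h :: "'i \<Rightarrow> bool \<Rightarrow> 'r::comm_semiring_1"
  assumes "finite I"
  shows "(\<Sum>y\<in>Pow I. \<Prod>i\<in>I. h i (i \<in> y)) = (\<Prod>i\<in>I. h i True + h i False)"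
  unfolding prod_add[OF assms]
proof (rule sum.cong[OF refl])
  fix y assume "y \<in> Pow I"
  then have "I = y \<union> (I - y)" "finite y" using assms finite_subset by auto
  then have "(\<Prod>i\<in>I. h i (i \<in> y)) = (\<Prod>i\<in>y. h i (i \<in> y)) * (\<Prod>i\<in>I - y. h i (i \<in> y))"
    using assms by (metis Diff_disjoint finite_Diff prod.union_disjoint)
  then show "(\<Prod>i\<in>I. h i (i \<in> y)) = (\<Prod>i\<in>y. h i True) * (\<Prod>i\<in>I - y. h i False)" by simp
qed

text \<open>A vector of the plane is a function of the second truth value \<open>c\<close>. In the order (False, True),
  \<open>tilt False\<close> is the orthogonal basis (1,2), (-2,1) and \<open>tilt True\<close> the orthogonal basis (1,-2), (2,1).
  The constants are chosen for two coincidences. Modulo 2 both bases are the standard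
  one, so the two can be mixed freely from coordinate to coordinate. Modulo 3 the vector of \<open>tilt False\<close>
  at \<open>b\<close> is, up to sign, that of \<open>tilt True\<close> at \<open>\<not> b\<close>, so one may switch between the bases if
  one also passes to the antipode.\<close>

definition tilt :: "bool \<Rightarrow> bool \<Rightarrow> bool \<Rightarrow> int" where
  "tilt s b c = (if b = c then 1 else if b = s then 2 else -2)"

lemma tilt_orthogonal: "b \<noteq> b' \<Longrightarrow> tilt s b True * tilt s b' True + tilt s b False * tilt s b' False = 0"
  by (auto simp: tilt_def)

text \<open>The tensor product of the plane vectors \<open>h i\<close>, as a vector indexed by the subsets of \<open>I\<close>.\<close>

definition tensor :: "'i set \<Rightarrow> ('i \<Rightarrow> bool \<Rightarrow> int) \<Rightarrow> 'i set \<Rightarrow> int" where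
  "tensor I h y = (\<Prod>i\<in>I. h i (i \<in> y))"

lemma tensor_inner:
  assumes "finite I"
  shows "(\<Sum>y\<in>Pow I. tensor I h y * tensor I k y)
    = (\<Prod>i\<in>I. h i True * k i True + h i False * k i False)"
  unfolding tensor_def prod.distrib[symmetric] by (rule sum_Pow_prod[OF assms])

lemma not_dvd_prod_units:
  fixes h :: "'i \<Rightarrow> int"
  assumes "prime p" "\<And>i. i \<in> I \<Longrightarrow> \<bar>h i\<bar> = 1"
  shows "\<not> p dvd (\<Prod>i\<in>I. h i)"
proof -
  have "\<bar>\<Prod>i\<in>I. h i\<bar> = 1" using assms(2) by (simp add: abs_prod)
  then show ?thesis using assms(1) by (metis dvd_abs_iff not_prime_unit)
qed

text \<open>Here \<open>s\<close> chooses the basis separately for each point and each coordinate. Modulo 2 the vector of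
  \<open>x\<close> is the standard basis vector of \<open>x\<close>.\<close>

lemma mixed_tilt_independent:
  assumes I: "finite I" and D: "D \<subseteq> Pow I"
    and eq: "\<And>y. y \<in> Pow I \<Longrightarrow> (\<Sum>x\<in>D. c x * tensor I (\<lambda>i. tilt (s x i) (i \<in> x)) y) = 0"
    and x: "x \<in> D"
  shows "c x = 0"
proof (rule independent_if_diagonal_mod_prime[where p = 2 and U = D
      and a = "\<lambda>x y. tensor I (\<lambda>i. tilt (s x i) (i \<in> x)) y"])
  show "finite D" using I D by (meson finite_Pow_iff finite_subset)
  fix z y assume zy: "z \<in> D" "y \<in> D" "z \<noteq> y"
  then obtain i where i: "i \<in> I" "(i \<in> z) \<noteq> (i \<in> y)" using D by blast
  then have "2 dvd tilt (s z i) (i \<in> z) (i \<in> y)" by (simp add: tilt_def)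
  then show "2 dvd tensor I (\<lambda>i. tilt (s z i) (i \<in> z)) y"
    unfolding tensor_def by (rule dvd_trans[OF _ dvd_prodI[OF I i(1)]])
next
  show "\<not> 2 dvd tensor I (\<lambda>i. tilt (s x i) (i \<in> x)) x" for x
    unfolding tensor_def by (rule not_dvd_prod_units) (simp_all add: tilt_def)
  show "(\<Sum>z\<in>D. c z * tensor I (\<lambda>i. tilt (s z i) (i \<in> z)) y) = 0" if "y \<in> D" for y
    using eq D that by blast
qed (simp_all add: x)

text \<open>Here each point uses one basis in all coordinates, and points with \<open>s z\<close> enter through
  their antipode. The test vectors are tensor products of (1,-1) and (1,1), the two directions to which
  the four plane vectors reduce modulo 3.\<close>

lemma pure_tilt_independent:
  assumes I: "finite I" and U: "U \<subseteq> Pow I"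
    and eq: "\<And>y. y \<in> Pow I \<Longrightarrow> (\<Sum>z\<in>U. c z * tensor I (\<lambda>i. tilt (s z) ((i \<in> z) \<noteq> s z)) y) = 0"
    and x: "x \<in> U"
  shows "c x = 0"
proof -
  let ?h = "\<lambda>x i b. if b \<and> i \<notin> x then - 1 else 1 :: int"
  let ?w = "\<lambda>z. tensor I (\<lambda>i. tilt (s z) ((i \<in> z) \<noteq> s z))"
  define g where "g z b = tilt (s z) (b \<noteq> s z)" for z b
  define a where "a z x = (\<Sum>y\<in>Pow I. ?w z y * tensor I (?h x) y)" for z x
  have a: "a z x = (\<Prod>i\<in>I. g z (i \<in> z) True * ?h x i True + g z (i \<in> z) False * ?h x i False)" for z x
    unfolding a_def tensor_inner[OF I] g_def ..
  show ?thesis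
  proof (rule independent_if_diagonal_mod_prime[where p = 3 and U = U and a = a])
    show "prime (3::int)" by simp
    show "finite U" using I U by (meson finite_Pow_iff finite_subset)
    show "(\<Sum>z\<in>U. c z * a z y) = 0" if "y \<in> U" for y
    proof -
      have "(\<Sum>z\<in>U. c z * a z y) = (\<Sum>t\<in>Pow I. (\<Sum>z\<in>U. c z * ?w z t) * tensor I (?h y) t)"
        unfolding a_def sum_distrib_left sum_distrib_right
        by (subst sum.swap) (simp add: mult.assoc)
      then show ?thesis using eq by simp
    qed
    fix z y assume zy: "z \<in> U" "y \<in> U" "z \<noteq> y"
    then obtain i where i: "i \<in> I" "(i \<in> z) \<noteq> (i \<in> y)" using U by blast
    then have "3 dvd g z (i \<in> z) True * ?h y i True + g z (i \<in> z) False * ?h y i False"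
      by (cases "s z"; cases "i \<in> z"; cases "i \<in> y") (simp_all add: tilt_def g_def)
    then show "3 dvd a z y"
      unfolding a by (rule dvd_trans[OF _ dvd_prodI[OF I i(1)]])
  next
    have "\<bar>g z (i \<in> z) True * ?h z i True + g z (i \<in> z) False * ?h z i False\<bar> = 1" for z i
      by (cases "s z"; cases "i \<in> z") (simp_all add: tilt_def g_def)
    then show "\<not> 3 dvd a z z" for z
      unfolding a by (intro not_dvd_prod_units) simp_all
  qed (rule x)
qed

text \<open>Too many vectors would satisfy a non-trivial relation, which splits as \<open>V + W = 0\<close> with \<open>V\<close>
  in the first span and \<open>W\<close> in the second. Orthogonality gives \<open>0 = V \<bullet> W = - (V \<bullet> V)\<close>, so both
  parts vanish, against independence of the two families.\<close>

lemma card_orthogonal_families: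
  fixes v :: "'x \<Rightarrow> 'e \<Rightarrow> int" and w :: "'z \<Rightarrow> 'e \<Rightarrow> int"
  assumes fin: "finite E" "finite D" "finite U"
    and orth: "\<And>x z. x \<in> D \<Longrightarrow> z \<in> U \<Longrightarrow> (\<Sum>e\<in>E. v x e * w z e) = 0"
    and v: "\<And>c. (\<And>e. e \<in> E \<Longrightarrow> (\<Sum>x\<in>D. c x * v x e) = 0) \<Longrightarrow> (\<And>x. x \<in> D \<Longrightarrow> c x = 0)"
    and w: "\<And>c. (\<And>e. e \<in> E \<Longrightarrow> (\<Sum>z\<in>U. c z * w z e) = 0) \<Longrightarrow> (\<And>z. z \<in> U \<Longrightarrow> c z = 0)"
  shows "card D + card U \<le> card E"
proof (rule ccontr)
  assume "\<not> ?thesis"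
  then have "card E < card (D <+> U)" using fin by (simp add: card_Plus)
  from exists_nontrivial_relation[OF fin(1) _ this, of "\<lambda>e. case_sum (\<lambda>x. v x e) (\<lambda>z. w z e)"] fin
  obtain c where nz: "\<exists>u\<in>D <+> U. c u \<noteq> 0"
    and eq: "\<forall>e\<in>E. (\<Sum>u\<in>D <+> U. c u * case_sum (\<lambda>x. v x e) (\<lambda>z. w z e) u) = 0"
    by auto
  define V where "V e = (\<Sum>x\<in>D. c (Inl x) * v x e)" for e
  define W where "W e = (\<Sum>z\<in>U. c (Inr z) * w z e)" for e
  have VW: "V e + W e = 0" if "e \<in> E" for e
    using eq that fin by (auto simp: sum.Plus V_def W_def o_def)
  have "(\<Sum>e\<in>E. V e * W e) = (\<Sum>x\<in>D. \<Sum>z\<in>U. c (Inl x) * c (Inr z) * (\<Sum>e\<in>E. v x e * w z e))"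
  proof -
    have "(\<Sum>e\<in>E. V e * W e)
        = (\<Sum>e\<in>E. \<Sum>x\<in>D. \<Sum>z\<in>U. c (Inl x) * c (Inr z) * (v x e * w z e))"
      unfolding V_def W_def sum_product by (simp add: mult_ac)
    also have "\<dots> = (\<Sum>x\<in>D. \<Sum>z\<in>U. \<Sum>e\<in>E. c (Inl x) * c (Inr z) * (v x e * w z e))"
      by (subst sum.swap, rule sum.cong[OF refl], rule sum.swap)
    finally show ?thesis unfolding sum_distrib_left .
  qed
  also have "\<dots> = 0" using orth by simp
  finally have "(\<Sum>e\<in>E. V e * W e) = 0" .
  moreover have "(\<Sum>e\<in>E. V e * W e) = - (\<Sum>e\<in>E. V e * V e)"
    unfolding sum_negf[symmetric]
  proof (rule sum.cong[OF refl])
    fix e assume "e \<in> E"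
    then have "W e = - V e" using VW by (simp add: eq_neg_iff_add_eq_0 add.commute)
    then show "V e * W e = - (V e * V e)" by simp
  qed
  ultimately have "(\<Sum>e\<in>E. V e * V e) = 0" by simp
  then have V0: "V e = 0" if "e \<in> E" for e
    using that fin by (subst (asm) sum_nonneg_eq_0_iff) auto
  then have W0: "W e = 0" if "e \<in> E" for e using VW that by fastforce
  have "c (Inl x) = 0" if "x \<in> D" for x using v[of "\<lambda>x. c (Inl x)"] V0 that by (simp add: V_def)
  moreover have "c (Inr z) = 0" if "z \<in> U" for z using w[of "\<lambda>z. c (Inr z)"] W0 that by (simp add: W_def)
  ultimately show False using nz by auto
qed

text \<open>A point \<open>x \<in> D\<close> carries the tensor with basis \<open>tilt False\<close> on \<open>K x\<close> and \<open>tilt True\<close> off \<open>K x\<close>.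
  A point \<open>z\<close> outside \<open>A\<close> carries the pure \<open>tilt False\<close> tensor of \<open>z\<close>; it differs from \<open>x\<close> somewhere
  on \<open>K x\<close>, and there the two factors are orthogonal. A point \<open>z \<in> A - B\<close> carries the pure \<open>tilt True\<close>
  tensor of its antipode; it differs from the antipode of \<open>x\<close> somewhere on \<open>L x\<close>, hence off \<open>K x\<close>,
  and there the factors are orthogonal again.\<close>

lemma reimer_cube:
  assumes I: "finite I" and D: "D \<subseteq> Pow I"
    and disj: "\<And>z. z \<in> D \<Longrightarrow> K z \<inter> L z = {}"
    and A: "\<And>z w. z \<in> D \<Longrightarrow> w \<subseteq> I \<Longrightarrow> K z \<inter> w = K z \<inter> z \<Longrightarrow> w \<in> A"
    and B: "\<And>z w. z \<in> D \<Longrightarrow> w \<subseteq> I \<Longrightarrow> L z \<inter> w = L z \<inter> (I - z) \<Longrightarrow> w \<in> B"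
  shows "card D \<le> card (Pow I \<inter> A \<inter> B)"
proof -
  let ?U = "Pow I - A \<inter> B"
  define v where "v x = tensor I (\<lambda>i. tilt (i \<notin> K x) (i \<in> x))" for x
  \<comment> \<open>Points of \<open>A\<close> in the complement of \<open>A \<inter> B\<close> use the second basis, at their antipode.\<close>
  define s where "s z \<longleftrightarrow> z \<in> A" for z
  define w where "w z = tensor I (\<lambda>i. tilt (s z) ((i \<in> z) \<noteq> s z))" for z
  have "card D + card ?U \<le> card (Pow I)"
  proof (rule card_orthogonal_families[where v = v and w = w])
    show "finite D" using I D by (meson finite_Pow_iff finite_subset)
    fix x z assume x: "x \<in> D" and z: "z \<in> ?U"
    have "\<exists>i\<in>I. (i \<notin> K x) = s z \<and> (i \<in> x) \<noteq> ((i \<in> z) \<noteq> s z)"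
    proof (cases "z \<in> A")
      case False
      then have "K x \<inter> z \<noteq> K x \<inter> x" using A x z by blast
      then show ?thesis using False x z D by (auto simp: s_def)
    next
      case True
      then have "z \<notin> B" using z by auto
      then have "L x \<inter> z \<noteq> L x \<inter> (I - x)" using B x z by blast
      then obtain i where "i \<in> L x" "i \<in> I" "(i \<in> z) = (i \<in> x)" using z by blast
      moreover from this have "i \<notin> K x" using disj x by blast
      ultimately show ?thesis using True by (auto simp: s_def)
    qed
    then obtain i where i: "i \<in> I" "(i \<notin> K x) = s z" "(i \<in> x) \<noteq> ((i \<in> z) \<noteq> s z)" by blast
    show "(\<Sum>e\<in>Pow I. v x e * w z e) = 0"
      unfolding v_def w_def tensor_inner[OF I]
      by (rule prod_zero[OF I], rule bexI[OF _ i(1)], unfold i(2), rule tilt_orthogonal, rule i(3))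
  next
    fix c x assume eq: "\<And>e. e \<in> Pow I \<Longrightarrow> (\<Sum>x\<in>D. c x * v x e) = 0" and x: "x \<in> D"
    show "c x = 0"
      by (rule mixed_tilt_independent[OF I D eq[unfolded v_def] x])
  next
    fix c z assume eq: "\<And>e. e \<in> Pow I \<Longrightarrow> (\<Sum>z\<in>?U. c z * w z e) = 0" and z: "z \<in> ?U"
    show "c z = 0"
      by (rule pure_tilt_independent[OF I Diff_subset eq[unfolded w_def] z])
  qed (use I in auto)
  moreover have "card (Pow I) = card (Pow I \<inter> A \<inter> B) + card ?U"
    using I by (subst card_Un_disjoint[symmetric]) (auto intro!: arg_cong[where f = card])
  ultimately show ?thesis by linarith
qed

section \<open>From sets to functions on the cube\<close>

lemma layer_cake: "(\<integral>\<^sup>+s. indicator {s. 0 \<le> s \<and> ennreal s < x} s \<partial>lborel) = x"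
proof (cases x)
  case (real r)
  then have "{s. 0 \<le> s \<and> ennreal s < x} = {0..<r}" by (auto simp: ennreal_less_iff)
  then show ?thesis using real by simp
next
  case top
  then have "{s. 0 \<le> s \<and> ennreal s < x} = {0..}" by auto
  moreover have "emeasure lborel {0::real..} = \<infinity>"
  proof (rule ccontr)
    assume "emeasure lborel {0::real..} \<noteq> \<infinity>"
    then obtain n where "emeasure lborel {0::real..} < of_nat n"
      using ennreal_Ex_less_of_nat by (auto simp: less_top)
    moreover have "of_nat n \<le> emeasure lborel {0::real..}"
      using emeasure_mono[of "{0..real n}" "{0..}" lborel] by (simp add: ennreal_of_nat_eq_real_of_nat)
    ultimately show False by simp
  qed
  ultimately show ?thesis using top by simp
qed

lemma layer_cake_mult:
  "x * y = (\<integral>\<^sup>+s. \<integral>\<^sup>+t. indicator {s. 0 \<le> s \<and> ennreal s < x} s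
      * indicator {t. 0 \<le> t \<and> ennreal t < y} t \<partial>lborel \<partial>lborel)"
proof -
  have "(\<lambda>s. indicator {s. 0 \<le> s \<and> ennreal s < x} s :: ennreal) \<in> borel_measurable lborel" for x
    by measurable
  then show ?thesis by (simp only: nn_integral_cmult nn_integral_multc layer_cake)
qed

text \<open>Writing each product as a double integral over levels \<open>s\<close>, \<open>t\<close> reduces the claim to
  \<open>reimer_cube\<close> for the level sets \<open>{z. s < F z}\<close> and \<open>{z. t < G z}\<close>.\<close>

lemma functional_reimer_cube:
  fixes F G \<phi> \<gamma> :: "'i set \<Rightarrow> ennreal"
  assumes I: "finite I"
    and disj: "\<And>z. z \<subseteq> I \<Longrightarrow> K z \<inter> L z = {}"
    and F: "\<And>z w. z \<subseteq> I \<Longrightarrow> w \<subseteq> I \<Longrightarrow> K z \<inter> w = K z \<inter> z \<Longrightarrow> \<phi> z \<le> F w"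
    and G: "\<And>z w. z \<subseteq> I \<Longrightarrow> w \<subseteq> I \<Longrightarrow> L z \<inter> w = L z \<inter> (I - z) \<Longrightarrow> \<gamma> z \<le> G w"
  shows "(\<Sum>z\<in>Pow I. \<phi> z * \<gamma> z) \<le> (\<Sum>z\<in>Pow I. F z * G z)"
proof -
  let ?i = "\<lambda>x s. indicator {s. 0 \<le> s \<and> ennreal s < x} s :: ennreal"
  have cake: "(\<Sum>z\<in>Pow I. a z * b z)
      = (\<integral>\<^sup>+s. \<integral>\<^sup>+t. (\<Sum>z\<in>Pow I. ?i (a z) s * ?i (b z) t) \<partial>lborel \<partial>lborel)" for a b
    by (subst layer_cake_mult) (simp add: nn_integral_sum)
  have le: "(\<Sum>z\<in>Pow I. ?i (\<phi> z) s * ?i (\<gamma> z) t) \<le> (\<Sum>z\<in>Pow I. ?i (F z) s * ?i (G z) t)" for s t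
  proof (cases "0 \<le> s \<and> 0 \<le> t")
    case False
    then show ?thesis by (auto simp: indicator_def)
  next
    case True
    have count: "(\<Sum>z\<in>Pow I. ?i (a z) s * ?i (b z) t)
        = of_nat (card {z\<in>Pow I. ennreal s < a z \<and> ennreal t < b z})" for a b
    proof -
      have "(\<Sum>z\<in>Pow I. ?i (a z) s * ?i (b z) t)
          = (\<Sum>z\<in>Pow I. if ennreal s < a z \<and> ennreal t < b z then 1 else 0)"
        using True by (intro sum.cong) (auto simp: indicator_def)
      then show ?thesis using I by (simp add: sum.If_cases Int_def)
    qed
    have "card {z\<in>Pow I. ennreal s < \<phi> z \<and> ennreal t < \<gamma> z}
        \<le> card (Pow I \<inter> {z. ennreal s < F z} \<inter> {z. ennreal t < G z})"
      by (rule reimer_cube[OF I, where K = K and L = L]) (use disj F G in \<open>auto intro: less_le_trans\<close>)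
    also have "Pow I \<inter> {z. ennreal s < F z} \<inter> {z. ennreal t < G z}
        = {z\<in>Pow I. ennreal s < F z \<and> ennreal t < G z}" by auto
    finally show ?thesis unfolding count by simp
  qed
  show ?thesis unfolding cake[of \<phi> \<gamma>] cake[of F G] by (intro nn_integral_mono le)
qed

section \<open>Exchanging coordinates between two independent copies\<close>

text \<open>Outside \<open>I\<close> both points of a product space over \<open>I\<close> take the default value \<open>undefined\<close>, hence
  so does the picked point, which therefore lies in the product space again.\<close>

definition pick :: "'i set \<Rightarrow> ('i \<Rightarrow> 'a) \<times> ('i \<Rightarrow> 'a) \<Rightarrow> 'i \<Rightarrow> 'a" where
  "pick Z p = (\<lambda>i. if i \<in> Z then fst p i else snd p i)"

definition exchange :: "'i set \<Rightarrow> ('i \<Rightarrow> 'a) \<times> ('i \<Rightarrow> 'a) \<Rightarrow> ('i \<Rightarrow> 'a) \<times> ('i \<Rightarrow> 'a)" where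
  "exchange Z p = (pick Z p, pick (- Z) p)"

lemma measurable_pick [measurable]:
  "pick Z \<in> measurable (PiM I M \<Otimes>\<^sub>M PiM I M) (PiM I M)"
proof -
  have "(\<lambda>p. pick Z p i) \<in> measurable (PiM I M \<Otimes>\<^sub>M PiM I M) (M i)" if "i \<in> I" for i
    using that unfolding pick_def by (cases "i \<in> Z") simp_all
  then have "(\<lambda>p. \<lambda>i\<in>I. pick Z p i) \<in> measurable (PiM I M \<Otimes>\<^sub>M PiM I M) (PiM I M)"
    by (rule measurable_restrict)
  moreover have "(\<lambda>i\<in>I. pick Z p i) = pick Z p"
    if "p \<in> space (PiM I M \<Otimes>\<^sub>M PiM I M)" for p
    using that by (cases p) (auto simp: pick_def space_pair_measure space_PiM PiE_iff extensional_def)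
  ultimately show ?thesis by (rule measurable_cong[THEN iffD1, rotated])
qed

lemma measurable_exchange [measurable]:
  "exchange Z \<in> measurable (PiM I M \<Otimes>\<^sub>M PiM I M) (PiM I M \<Otimes>\<^sub>M PiM I M)"
  unfolding exchange_def by measurable

text \<open>A pair of points of a product is one point of the product over \<open>UNIV \<times> I\<close>. There the exchange of
  coordinates becomes a permutation of the index set, under which a product measure is
  invariant.\<close>

definition join_pair :: "'i set \<Rightarrow> ('i \<Rightarrow> 'a) \<times> ('i \<Rightarrow> 'a) \<Rightarrow> bool \<times> 'i \<Rightarrow> 'a" where
  "join_pair I p = (\<lambda>j\<in>UNIV \<times> I. if fst j then fst p (snd j) else snd p (snd j))"

definition split_pair :: "'i set \<Rightarrow> (bool \<times> 'i \<Rightarrow> 'a) \<Rightarrow> ('i \<Rightarrow> 'a) \<times> ('i \<Rightarrow> 'a)" where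
  "split_pair I w = (\<lambda>i\<in>I. w (True, i), \<lambda>i\<in>I. w (False, i))"

lemma measurable_join_pair [measurable]:
  "join_pair I \<in> measurable (PiM I M \<Otimes>\<^sub>M PiM I M) (PiM (UNIV \<times> I) (\<lambda>j. M (snd j)))"
  unfolding join_pair_def
proof (rule measurable_restrict)
  fix j :: "bool \<times> 'a" assume "j \<in> UNIV \<times> I"
  then show "(\<lambda>p. if fst j then fst p (snd j) else snd p (snd j))
      \<in> measurable (PiM I M \<Otimes>\<^sub>M PiM I M) (M (snd j))"
    by (cases "fst j") auto
qed

lemma measurable_split_pair [measurable]:
  "split_pair I \<in> measurable (PiM (UNIV \<times> I) (\<lambda>j. M (snd j))) (PiM I M \<Otimes>\<^sub>M PiM I M)"
proof -
  have "(\<lambda>w. w (b, i)) \<in> measurable (PiM (UNIV \<times> I) (\<lambda>j. M (snd j))) (M i)" if "i \<in> I" for b i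
    using measurable_component_singleton[of "(b, i)" "UNIV \<times> I" "\<lambda>j. M (snd j)"] that by simp
  then show ?thesis
    unfolding split_pair_def by (intro measurable_Pair measurable_restrict)
qed

context finite_product_prob_space
begin

lemma distr_join_pair:
  "distr (PiM I M \<Otimes>\<^sub>M PiM I M) (PiM (UNIV \<times> I) (\<lambda>j. M (snd j))) (join_pair I)
    = PiM (UNIV \<times> I) (\<lambda>j. M (snd j))"
proof -
  interpret J: product_sigma_finite "\<lambda>j::bool \<times> 'a. M (snd j)"
    by unfold_locales
  have fin: "finite I" by (rule finite_index)
  show ?thesis
  proof (rule J.PiM_eqI)
    fix A :: "bool \<times> 'a \<Rightarrow> 'b set" assume A: "\<And>j. j \<in> UNIV \<times> I \<Longrightarrow> A j \<in> sets (M (snd j))"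
    let ?B = "\<lambda>b. PiE I (\<lambda>i. A (b, i))"
    have sub: "A (b, i) \<subseteq> space (M i)" if "i \<in> I" for b i
      using A[of "(b, i)"] that sets.sets_into_space by auto
    have pre: "join_pair I -` PiE (UNIV \<times> I) A \<inter> space (PiM I M \<Otimes>\<^sub>M PiM I M) = ?B True \<times> ?B False"
    proof (intro set_eqI iffI)
      fix p assume "p \<in> join_pair I -` PiE (UNIV \<times> I) A \<inter> space (PiM I M \<Otimes>\<^sub>M PiM I M)"
      then have p: "\<And>b i. i \<in> I \<Longrightarrow> join_pair I p (b, i) \<in> A (b, i)"
        and "fst p \<in> space (PiM I M)" "snd p \<in> space (PiM I M)"
        by (auto simp: space_pair_measure)
      then show "p \<in> ?B True \<times> ?B False"
        using p[of _ True] p[of _ False]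
        by (cases p) (auto simp: join_pair_def space_PiM PiE_iff)
    next
      fix p assume "p \<in> ?B True \<times> ?B False"
      then show "p \<in> join_pair I -` PiE (UNIV \<times> I) A \<inter> space (PiM I M \<Otimes>\<^sub>M PiM I M)"
        using sub by (cases p) (fastforce simp: join_pair_def space_pair_measure space_PiM PiE_iff)
    qed
    have B: "?B b \<in> sets (PiM I M)" for b
      using A fin by (intro sets_PiM_I_finite) auto
    have "emeasure (distr (PiM I M \<Otimes>\<^sub>M PiM I M) (PiM (UNIV \<times> I) (\<lambda>j. M (snd j))) (join_pair I))
        (PiE (UNIV \<times> I) A) = emeasure (PiM I M \<Otimes>\<^sub>M PiM I M) (?B True \<times> ?B False)"
      unfolding pre[symmetric] using A fin
      by (intro emeasure_distr measurable_join_pair sets_PiM_I_finite) auto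
    also have "\<dots> = emeasure (PiM I M) (?B True) * emeasure (PiM I M) (?B False)"
      by (intro emeasure_pair_measure_Times B)
    also have "\<dots> = (\<Prod>b\<in>UNIV. \<Prod>i\<in>I. emeasure (M i) (A (b, i)))"
    proof -
      have "emeasure (PiM I M) (?B b) = (\<Prod>i\<in>I. emeasure (M i) (A (b, i)))" for b
        using A by (intro measure_times) auto
      then show ?thesis by (simp add: UNIV_bool mult.commute)
    qed
    also have "\<dots> = (\<Prod>j\<in>UNIV \<times> I. emeasure (M (snd j)) (A j))"
      by (simp add: prod.cartesian_product split_beta)
    finally show "emeasure (distr (PiM I M \<Otimes>\<^sub>M PiM I M) (PiM (UNIV \<times> I) (\<lambda>j. M (snd j))) (join_pair I))
        (PiE (UNIV \<times> I) A) = (\<Prod>j\<in>UNIV \<times> I. emeasure (M (snd j)) (A j))" .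
  qed (use fin in auto)
qed

lemma distr_exchange:
  "distr (PiM I M \<Otimes>\<^sub>M PiM I M) (PiM I M \<Otimes>\<^sub>M PiM I M) (exchange Z) = PiM I M \<Otimes>\<^sub>M PiM I M"
proof -
  let ?Q = "PiM I M \<Otimes>\<^sub>M PiM I M" and ?J = "PiM (UNIV \<times> I) (\<lambda>j::bool \<times> 'a. M (snd j))"
  \<comment> \<open>Keeps the label on coordinates in \<open>Z\<close> and flips it elsewhere, in line with \<open>pick Z\<close>, which
    takes the first point on \<open>Z\<close>.\<close>
  define \<tau> :: "bool \<times> 'a \<Rightarrow> bool \<times> 'a" where "\<tau> j = (fst j = (snd j \<in> Z), snd j)" for j
  define r :: "(bool \<times> 'a \<Rightarrow> 'b) \<Rightarrow> bool \<times> 'a \<Rightarrow> 'b" where "r w = (\<lambda>j\<in>UNIV \<times> I. w (\<tau> j))" for w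
  have snd_\<tau>: "snd (\<tau> j) = snd j" for j by (simp add: \<tau>_def)
  have r_meas: "r \<in> measurable ?J ?J"
    unfolding r_def
  proof (rule measurable_restrict)
    fix j :: "bool \<times> 'a" assume "j \<in> UNIV \<times> I"
    then have "\<tau> j \<in> UNIV \<times> I" by (auto simp: \<tau>_def)
    from measurable_component_singleton[OF this, of "\<lambda>j. M (snd j)"]
    show "(\<lambda>w. w (\<tau> j)) \<in> measurable ?J (M (snd j))" by (simp add: snd_\<tau>)
  qed
  have r_distr: "distr ?J ?J r = ?J"
    unfolding r_def
  proof (rule distr_PiM_reindex[of "UNIV \<times> I" "\<lambda>j. M (snd j)" \<tau> "UNIV \<times> I", unfolded snd_\<tau>])
    show "inj_on \<tau> (UNIV \<times> I)" "\<tau> \<in> UNIV \<times> I \<rightarrow> UNIV \<times> I"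
      by (auto simp: inj_on_def \<tau>_def)
  qed (rule prob_space)
  have split_distr: "distr ?J ?Q (split_pair I) = ?Q"
  proof -
    have "distr ?J ?Q (split_pair I) = distr ?Q ?Q (split_pair I \<circ> join_pair I)"
      by (subst distr_join_pair[symmetric]) (simp add: distr_distr)
    also have "\<dots> = distr ?Q ?Q (\<lambda>p. p)"
      by (rule distr_cong)
        (auto simp: split_pair_def join_pair_def space_pair_measure space_PiM PiE_iff extensional_def)
    finally show ?thesis by (simp add: distr_id2)
  qed
  have "distr ?Q ?Q (exchange Z) = distr ?Q ?Q (split_pair I \<circ> (r \<circ> join_pair I))"
    by (rule distr_cong)
      (auto simp: split_pair_def join_pair_def exchange_def pick_def r_def \<tau>_def
        space_pair_measure space_PiM PiE_iff extensional_def)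
  also have "\<dots> = distr (distr (distr ?Q ?J (join_pair I)) ?J r) ?Q (split_pair I)"
    using r_meas by (simp add: distr_distr)
  finally show ?thesis by (simp add: distr_join_pair r_distr split_distr)
qed

lemma distr_pick:
  "distr (PiM I M \<Otimes>\<^sub>M PiM I M) (PiM I M) (pick Z) = PiM I M"
proof -
  let ?P = "PiM I M"
  have "distr (?P \<Otimes>\<^sub>M ?P) ?P (pick Z) = distr (distr (?P \<Otimes>\<^sub>M ?P) (?P \<Otimes>\<^sub>M ?P) (exchange Z)) ?P fst"
    by (subst distr_distr) (auto simp: exchange_def o_def)
  also have "\<dots> = distr (?P \<Otimes>\<^sub>M ?P) ?P fst" by (simp add: distr_exchange)
  also have "\<dots> = ?P"
    by (rule distr_pair_fst)
  finally show ?thesis .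
qed

text \<open>The common core of both frameworks. Averaging over exchanges turns both sides into sums
  over the cube. Almost surely the bounds \<open>\<phi> K \<le> F\<close> and \<open>\<gamma> L \<le> G\<close> hold at the finitely many points
  that arise from one pair by picking coordinates. If \<open>W\<close> agrees with \<open>Z\<close> on \<open>K\<close>, then \<open>\<phi> K\<close> has the same value at
  both picked points, so its value at \<open>Z\<close> is a lower bound for \<open>F\<close> on the whole face of the
  cube. This is the hypothesis of \<open>functional_reimer_cube\<close>.\<close>

lemma dual_reimer_integral:
  assumes H: "H \<in> borel_measurable (PiM I M \<Otimes>\<^sub>M PiM I M)"
    and F: "F \<in> borel_measurable (PiM I M)" and G: "G \<in> borel_measurable (PiM I M)"
    and H_le: "\<And>x y. x \<in> space (PiM I M) \<Longrightarrow> y \<in> space (PiM I M) \<Longrightarrow>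
        \<exists>K L. K \<subseteq> I \<and> L \<subseteq> I \<and> K \<inter> L = {} \<and> H (x, y) \<le> \<phi> K x * \<gamma> L y"
    and \<phi>_dep: "\<And>K x y. K \<subseteq> I \<Longrightarrow> x \<in> space (PiM I M) \<Longrightarrow> y \<in> space (PiM I M) \<Longrightarrow>
        restrict x K = restrict y K \<Longrightarrow> \<phi> K x = \<phi> K y"
    and \<gamma>_dep: "\<And>L x y. L \<subseteq> I \<Longrightarrow> x \<in> space (PiM I M) \<Longrightarrow> y \<in> space (PiM I M) \<Longrightarrow>
        restrict x L = restrict y L \<Longrightarrow> \<gamma> L x = \<gamma> L y"
    and \<phi>_le: "\<And>K. K \<subseteq> I \<Longrightarrow> AE x in PiM I M. \<phi> K x \<le> F x"
    and \<gamma>_le: "\<And>L. L \<subseteq> I \<Longrightarrow> AE x in PiM I M. \<gamma> L x \<le> G x"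
  shows "(\<integral>\<^sup>+p. H p \<partial>(PiM I M \<Otimes>\<^sub>M PiM I M)) \<le> (\<integral>\<^sup>+x. F x * G x \<partial>PiM I M)"
proof -
  let ?P = "PiM I M"
  let ?Q = "?P \<Otimes>\<^sub>M ?P"
  note [measurable] = H F G
  have fin: "finite I" by (rule finite_index)
  define good where "good x \<longleftrightarrow> (\<forall>K\<in>Pow I. \<phi> K x \<le> F x \<and> \<gamma> K x \<le> G x)" for x
  have "AE x in ?P. good x"
    unfolding good_def using fin \<phi>_le \<gamma>_le by (intro AE_finite_allI) auto
  then have good_pick: "AE p in ?Q. good (pick Z p)" for Z
    by (subst (asm) distr_pick[of Z, symmetric]) (rule AE_distrD[OF measurable_pick])
  have "AE p in ?Q. \<forall>Z\<in>Pow I. good (pick Z p)"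
    using fin good_pick by (intro AE_finite_allI) auto
  then have cube: "AE p in ?Q. (\<Sum>Z\<in>Pow I. H (exchange Z p)) \<le> (\<Sum>Z\<in>Pow I. F (pick Z p) * G (pick Z p))"
  proof (rule AE_mp, intro AE_I2 impI)
    fix p assume p: "p \<in> space ?Q" and good: "\<forall>Z\<in>Pow I. good (pick Z p)"
    have sp: "pick Z p \<in> space ?P" for Z
      using measurable_space[OF measurable_pick p] .
    have "\<forall>Z. \<exists>K L. K \<subseteq> I \<and> L \<subseteq> I \<and> K \<inter> L = {} \<and>
        H (exchange Z p) \<le> \<phi> K (pick Z p) * \<gamma> L (pick (- Z) p)"
      unfolding exchange_def using H_le sp by blast
    then obtain K L where KL: "\<And>Z. K Z \<subseteq> I" "\<And>Z. L Z \<subseteq> I" "\<And>Z. K Z \<inter> L Z = {}"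
      and le: "\<And>Z. H (exchange Z p) \<le> \<phi> (K Z) (pick Z p) * \<gamma> (L Z) (pick (- Z) p)"
      by metis
    have "(\<Sum>Z\<in>Pow I. H (exchange Z p))
        \<le> (\<Sum>Z\<in>Pow I. \<phi> (K Z) (pick Z p) * \<gamma> (L Z) (pick (- Z) p))"
      by (intro sum_mono le)
    also have "\<dots> \<le> (\<Sum>Z\<in>Pow I. F (pick Z p) * G (pick Z p))"
    proof (rule functional_reimer_cube[OF fin, where K = K and L = L])
      fix Z W assume ZW: "Z \<subseteq> I" "W \<subseteq> I"
      {
        assume eq: "K Z \<inter> W = K Z \<inter> Z"
        then have "restrict (pick Z p) (K Z) = restrict (pick W p) (K Z)"
          by (auto simp: pick_def restrict_def fun_eq_iff)
        then have "\<phi> (K Z) (pick Z p) = \<phi> (K Z) (pick W p)"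
          using KL sp by (intro \<phi>_dep)
        also have "\<dots> \<le> F (pick W p)" using good ZW KL unfolding good_def by blast
        finally show "\<phi> (K Z) (pick Z p) \<le> F (pick W p)" .
      }
      {
        assume eq: "L Z \<inter> W = L Z \<inter> (I - Z)"
        then have "restrict (pick (- Z) p) (L Z) = restrict (pick W p) (L Z)"
          using KL(2)[of Z] by (auto simp: pick_def restrict_def fun_eq_iff)
        then have "\<gamma> (L Z) (pick (- Z) p) = \<gamma> (L Z) (pick W p)"
          using KL sp by (intro \<gamma>_dep)
        also have "\<dots> \<le> G (pick W p)" using good ZW KL unfolding good_def by blast
        finally show "\<gamma> (L Z) (pick (- Z) p) \<le> G (pick W p)" .
      }
    qed (rule KL)
    finally show "(\<Sum>Z\<in>Pow I. H (exchange Z p)) \<le> (\<Sum>Z\<in>Pow I. F (pick Z p) * G (pick Z p))" .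
  qed
  have H_exchange: "(\<integral>\<^sup>+p. H (exchange Z p) \<partial>?Q) = (\<integral>\<^sup>+p. H p \<partial>?Q)" for Z
    by (subst (2) distr_exchange[of Z, symmetric]) (simp add: nn_integral_distr)
  have FG_pick: "(\<integral>\<^sup>+p. F (pick Z p) * G (pick Z p) \<partial>?Q) = (\<integral>\<^sup>+x. F x * G x \<partial>?P)" for Z
    by (subst (3) distr_pick[of Z, symmetric]) (simp add: nn_integral_distr)
  have "of_nat (card (Pow I)) * (\<integral>\<^sup>+p. H p \<partial>?Q) = (\<integral>\<^sup>+p. (\<Sum>Z\<in>Pow I. H (exchange Z p)) \<partial>?Q)"
    by (simp add: nn_integral_sum H_exchange)
  also have "\<dots> \<le> (\<integral>\<^sup>+p. (\<Sum>Z\<in>Pow I. F (pick Z p) * G (pick Z p)) \<partial>?Q)"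
    by (rule nn_integral_mono_AE[OF cube])
  also have "\<dots> = of_nat (card (Pow I)) * (\<integral>\<^sup>+x. F x * G x \<partial>?P)"
    by (simp add: nn_integral_sum FG_pick)
  finally have le: "of_nat (card (Pow I)) * (\<integral>\<^sup>+p. H p \<partial>?Q) \<le> of_nat (card (Pow I)) * (\<integral>\<^sup>+x. F x * G x \<partial>?P)" .
  have "card (Pow I) \<noteq> 0" using fin by (auto simp: card_eq_0_iff)
  then show ?thesis using le by (simp add: ennreal_mult_le_mult_iff)
qed

end

section \<open>Essential infima\<close>

text \<open>The essential infimum is a supremum of possibly uncountably many almost sure lower
  bounds; rational bounds suffice, and countably many exceptional null sets have a null union.\<close>

lemma AE_ess_inf_le:
  fixes h :: "'a \<Rightarrow> ennreal"
  shows "AE z in N. ess_inf N h \<le> h z"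
proof -
  have "AE z in N. \<forall>r::rat. (AE z in N. ennreal (of_rat r) \<le> h z) \<longrightarrow> ennreal (of_rat r) \<le> h z"
    by (subst AE_all_countable) auto
  then show ?thesis
  proof (rule AE_mp, intro AE_I2 impI)
    fix z assume z: "\<forall>r::rat. (AE z in N. ennreal (of_rat r) \<le> h z) \<longrightarrow> ennreal (of_rat r) \<le> h z"
    show "ess_inf N h \<le> h z"
    proof (rule ccontr)
      assume "\<not> ?thesis"
      then obtain c where c: "AE z in N. c \<le> h z" "h z < c"
        unfolding ess_inf_def by (auto simp: not_le less_Sup_iff)
      then obtain r :: rat where r: "h z < of_rat r" "ennreal (of_rat r) < c"
        using ennreal_rat_dense by blast
      have "AE z in N. ennreal (of_rat r) \<le> h z"
        using c(1) by eventually_elim (use r in auto)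
      then show False using z r by (auto simp: not_le[symmetric])
    qed
  qed
qed

text \<open>The essential infimum exceeds \<open>c\<close> iff some rational above \<open>c\<close> is an almost sure lower bound, that is,
  iff the section of a measurable set is null, and the measure of a section is a measurable
  function.\<close>

lemma measurable_ess_inf:
  fixes h :: "'b \<Rightarrow> 'a \<Rightarrow> ennreal"
  assumes "prob_space N"
    and h [measurable]: "case_prod h \<in> borel_measurable (T \<Otimes>\<^sub>M N)"
  shows "(\<lambda>x. ess_inf N (h x)) \<in> borel_measurable T"
proof (rule borel_measurableI_greater)
  fix c :: ennreal
  interpret N: prob_space N by fact
  let ?R = "{r::rat. c < ennreal (of_rat r)}"
  have "c < ess_inf N (h x) \<longleftrightarrow> (\<exists>r\<in>?R. AE z in N. ennreal (of_rat r) \<le> h x z)" for x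
  proof
    assume "c < ess_inf N (h x)"
    then obtain d where d: "AE z in N. d \<le> h x z" "c < d"
      unfolding ess_inf_def by (auto simp: less_Sup_iff)
    then obtain r :: rat where r: "c < of_rat r" "ennreal (of_rat r) < d"
      using ennreal_rat_dense by blast
    have "AE z in N. ennreal (of_rat r) \<le> h x z"
      using d(1) by eventually_elim (use r in auto)
    then show "\<exists>r\<in>?R. AE z in N. ennreal (of_rat r) \<le> h x z" using r by auto
  next
    assume "\<exists>r\<in>?R. AE z in N. ennreal (of_rat r) \<le> h x z"
    then show "c < ess_inf N (h x)"
      unfolding ess_inf_def by (auto simp: less_Sup_iff)
  qed
  moreover have "(AE z in N. ennreal (of_rat r) \<le> h x z)
      \<longleftrightarrow> emeasure N {z\<in>space N. h x z < ennreal (of_rat r)} = 0" if "x \<in> space T" for x r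
    by (subst AE_iff_measurable[OF _ refl]) (use that in \<open>auto simp: not_le\<close>)
  ultimately have "{x\<in>space T. c < ess_inf N (h x)}
      = (\<Union>r\<in>?R. {x\<in>space T. emeasure N {z\<in>space N. h x z < ennreal (of_rat r)} = 0})"
    by auto
  also have "\<dots> \<in> sets T"
    by (intro sets.countable_UN') auto
  finally show "{x\<in>space T. c < ess_inf N (h x)} \<in> sets T" .
qed

section \<open>Random choice of the coordinate sets\<close>

lemma measurable_selected_product:
  fixes \<phi> :: "'i set \<Rightarrow> 'x \<Rightarrow> ennreal" and \<gamma> :: "'i set \<Rightarrow> 'y \<Rightarrow> ennreal"
  assumes I: "finite I"
    and K: "\<kappa> \<in> measurable (S \<Otimes>\<^sub>M T) (count_space (Pow I))"
    and L: "\<Lambda> \<in> measurable (S \<Otimes>\<^sub>M T) (count_space (Pow I))"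
    and \<phi>: "\<And>K. K \<subseteq> I \<Longrightarrow> \<phi> K \<in> borel_measurable S"
    and \<gamma>: "\<And>L. L \<subseteq> I \<Longrightarrow> \<gamma> L \<in> borel_measurable T"
  shows "(\<lambda>p. \<phi> (\<kappa> p) (fst p) * \<gamma> (\<Lambda> p) (snd p)) \<in> borel_measurable (S \<Otimes>\<^sub>M T)"
proof (rule borel_measurable_times_ennreal)
  have countable: "countable (Pow I)" using I by (simp add: countable_finite)
  show "(\<lambda>p. \<phi> (\<kappa> p) (fst p)) \<in> borel_measurable (S \<Otimes>\<^sub>M T)"
    by (rule measurable_compose_countable'[OF _ K countable])
      (rule measurable_compose[OF measurable_fst \<phi>], simp)
  show "(\<lambda>p. \<gamma> (\<Lambda> p) (snd p)) \<in> borel_measurable (S \<Otimes>\<^sub>M T)"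
    by (rule measurable_compose_countable'[OF _ L countable])
      (rule measurable_compose[OF measurable_snd \<gamma>], simp)
qed

context finite_product_prob_space
begin

lemma dual_reimer_selected:
  assumes K: "\<kappa> \<in> measurable (PiM I M \<Otimes>\<^sub>M PiM I M) (count_space (Pow I))"
    and L: "\<Lambda> \<in> measurable (PiM I M \<Otimes>\<^sub>M PiM I M) (count_space (Pow I))"
    and disj: "\<And>x y. x \<in> space (PiM I M) \<Longrightarrow> y \<in> space (PiM I M) \<Longrightarrow> \<kappa> (x, y) \<inter> \<Lambda> (x, y) = {}"
    and F: "F \<in> borel_measurable (PiM I M)" and G: "G \<in> borel_measurable (PiM I M)"
    and \<phi>: "\<And>K. K \<subseteq> I \<Longrightarrow> \<phi> K \<in> borel_measurable (PiM I M)"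
    and \<gamma>: "\<And>L. L \<subseteq> I \<Longrightarrow> \<gamma> L \<in> borel_measurable (PiM I M)"
    and \<phi>_dep: "\<And>K x y. K \<subseteq> I \<Longrightarrow> x \<in> space (PiM I M) \<Longrightarrow> y \<in> space (PiM I M) \<Longrightarrow>
        restrict x K = restrict y K \<Longrightarrow> \<phi> K x = \<phi> K y"
    and \<gamma>_dep: "\<And>L x y. L \<subseteq> I \<Longrightarrow> x \<in> space (PiM I M) \<Longrightarrow> y \<in> space (PiM I M) \<Longrightarrow>
        restrict x L = restrict y L \<Longrightarrow> \<gamma> L x = \<gamma> L y"
    and \<phi>_le: "\<And>K. K \<subseteq> I \<Longrightarrow> AE x in PiM I M. \<phi> K x \<le> F x"
    and \<gamma>_le: "\<And>L. L \<subseteq> I \<Longrightarrow> AE x in PiM I M. \<gamma> L x \<le> G x"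
  shows "(\<integral>\<^sup>+p. \<phi> (\<kappa> p) (fst p) * \<gamma> (\<Lambda> p) (snd p) \<partial>(PiM I M \<Otimes>\<^sub>M PiM I M))
    \<le> (\<integral>\<^sup>+x. F x * G x \<partial>PiM I M)"
proof (rule dual_reimer_integral[OF _ F G _ \<phi>_dep \<gamma>_dep \<phi>_le \<gamma>_le])
  show "(\<lambda>p. \<phi> (\<kappa> p) (fst p) * \<gamma> (\<Lambda> p) (snd p)) \<in> borel_measurable (PiM I M \<Otimes>\<^sub>M PiM I M)"
    by (rule measurable_selected_product[OF finite_index K L \<phi> \<gamma>])
  fix x y assume "x \<in> space (PiM I M)" "y \<in> space (PiM I M)"
  then show "\<exists>K L. K \<subseteq> I \<and> L \<subseteq> I \<and> K \<inter> L = {} \<and>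
      \<phi> (\<kappa> (x, y)) (fst (x, y)) * \<gamma> (\<Lambda> (x, y)) (snd (x, y)) \<le> \<phi> K x * \<gamma> L y"
    using disj measurable_space[OF K, of "(x, y)"] measurable_space[OF L, of "(x, y)"]
    by (intro exI[of _ "\<kappa> (x, y)"] exI[of _ "\<Lambda> (x, y)"]) (auto simp: space_pair_measure)
qed

section \<open>Infima over fibres and suprema over indices\<close>

definition fibre_ess_inf :: "(('a \<Rightarrow> 'b) \<Rightarrow> ennreal) \<Rightarrow> 'a set \<Rightarrow> ('a \<Rightarrow> 'b) \<Rightarrow> ennreal" where
  "fibre_ess_inf F K x = ess_inf (PiM (I - K) M) (\<lambda>w. F (merge K (I - K) (x, w)))"

lemma fibre_ess_inf_cong:
  assumes "restrict x K = restrict y K"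
  shows "fibre_ess_inf F K x = fibre_ess_inf F K y"
proof -
  have "x i = y i" if "i \<in> K" for i using fun_cong[OF assms, of i] that by simp
  then have "merge K (I - K) (x, w) = merge K (I - K) (y, w)" for w
    by (auto simp: merge_def fun_eq_iff)
  then show ?thesis by (simp add: fibre_ess_inf_def)
qed

lemma measurable_fibre_ess_inf:
  assumes F [measurable]: "F \<in> borel_measurable (PiM I M)" and K: "K \<subseteq> I"
  shows "fibre_ess_inf F K \<in> borel_measurable (PiM I M)"
  unfolding fibre_ess_inf_def
proof (rule measurable_ess_inf)
  show "prob_space (PiM (I - K) M)" by (rule prob_space_PiM) (rule prob_space)
  have "K \<union> (I - K) = I" using K by auto
  then have merge: "merge K (I - K) \<in> measurable (PiM K M \<Otimes>\<^sub>M PiM (I - K) M) (PiM I M)"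
    using measurable_merge[of K "I - K" M] by simp
  \<comment> \<open>Merging reads its first argument on \<open>K\<close> only; restricting that argument first factors the map
    through the product over \<open>K\<close>, where merging is measurable.\<close>
  have restr: "(\<lambda>p. (restrict (fst p) K, snd p))
      \<in> measurable (PiM I M \<Otimes>\<^sub>M PiM (I - K) M) (PiM K M \<Otimes>\<^sub>M PiM (I - K) M)"
    by (intro measurable_Pair measurable_compose[OF measurable_fst measurable_restrict_subset] K
        measurable_snd)
  have "(\<lambda>p. F (merge K (I - K) (restrict (fst p) K, snd p)))
      \<in> borel_measurable (PiM I M \<Otimes>\<^sub>M PiM (I - K) M)"
    by (rule measurable_compose[OF measurable_compose[OF restr merge] F])
  also have "(\<lambda>p. F (merge K (I - K) (restrict (fst p) K, snd p)))
      = (\<lambda>(x, w). F (merge K (I - K) (x, w)))"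
    by (auto simp: fun_eq_iff merge_def intro!: arg_cong[where f = F])
  finally show "(\<lambda>(x, w). F (merge K (I - K) (x, w))) \<in> borel_measurable (PiM I M \<Otimes>\<^sub>M PiM (I - K) M)" .
qed

text \<open>Split \<open>x\<close> as \<open>(u, w)\<close> with \<open>u\<close> carrying the coordinates in \<open>K\<close>. The left side depends on \<open>u\<close> only, and
  for each fixed \<open>u\<close> it is the essential infimum of \<open>F\<close> in \<open>w\<close>, so Fubini applies.\<close>

lemma AE_fibre_ess_inf_le:
  assumes F [measurable]: "F \<in> borel_measurable (PiM I M)" and K: "K \<subseteq> I"
  shows "AE x in PiM I M. fibre_ess_inf F K x \<le> F x"
proof -
  let ?J = "I - K"
  have fin: "finite K" "finite ?J" using finite_index K finite_subset by auto
  interpret A: finite_product_prob_space M K by unfold_locales (rule fin)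
  interpret B: finite_product_prob_space M ?J by unfold_locales (rule fin)
  interpret AB: pair_sigma_finite "PiM K M" "PiM ?J M" ..
  have un: "K \<union> ?J = I" using K by auto
  have merge [measurable]: "merge K ?J \<in> measurable (PiM K M \<Otimes>\<^sub>M PiM ?J M) (PiM I M)"
    using measurable_merge[of K ?J M] unfolding un .
  have [measurable]: "fibre_ess_inf F K \<in> borel_measurable (PiM I M)"
    by (rule measurable_fibre_ess_inf[OF F K])
  have distr: "distr (PiM K M \<Otimes>\<^sub>M PiM ?J M) (PiM I M) (merge K ?J) = PiM I M"
    using distr_merge[of K ?J] fin unfolding un by simp
  have "AE p in PiM K M \<Otimes>\<^sub>M PiM ?J M. fibre_ess_inf F K (merge K ?J p) \<le> F (merge K ?J p)"
  proof (rule AB.AE_pair_measure)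
    have "AE w in PiM ?J M. fibre_ess_inf F K (merge K ?J (u, w)) \<le> F (merge K ?J (u, w))" for u
    proof -
      have "fibre_ess_inf F K (merge K ?J (u, w)) = fibre_ess_inf F K u" for w
        by (rule fibre_ess_inf_cong) (simp add: merge_def restrict_def fun_eq_iff)
      then show ?thesis using AE_ess_inf_le by (simp add: fibre_ess_inf_def)
    qed
    then show "AE u in PiM K M. AE w in PiM ?J M. fibre_ess_inf F K (merge K ?J (u, w)) \<le> F (merge K ?J (u, w))"
      by simp
  qed measurable
  then show ?thesis
    by (subst distr[symmetric], subst AE_distr_iff) auto
qed

end

lemma SUP_times_ennreal:
  fixes a :: "'i \<Rightarrow> ennreal"
  shows "(SUP (i, j)\<in>A \<times> B. a i * b j) = (SUP i\<in>A. a i) * (SUP j\<in>B. b j)"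
proof (rule antisym)
  show "(SUP (i, j)\<in>A \<times> B. a i * b j) \<le> (SUP i\<in>A. a i) * (SUP j\<in>B. b j)"
  proof (rule SUP_least, clarify)
    fix i j assume "i \<in> A" "j \<in> B"
    then show "a i * b j \<le> (SUP i\<in>A. a i) * (SUP j\<in>B. b j)"
      by (intro mult_mono SUP_upper) simp_all
  qed
  have "(SUP i\<in>A. a i) * (SUP j\<in>B. b j) = (SUP i\<in>A. SUP j\<in>B. a i * b j)"
    by (subst SUP_mult_right_ennreal) (simp add: SUP_mult_left_ennreal)
  also have "\<dots> \<le> (SUP (i, j)\<in>A \<times> B. a i * b j)"
  proof (intro SUP_least)
    fix i j assume "i \<in> A" "j \<in> B"
    then show "a i * b j \<le> (SUP (i, j)\<in>A \<times> B. a i * b j)"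
      by (intro SUP_upper2[of "(i, j)"]) simp_all
  qed
  finally show "(SUP i\<in>A. a i) * (SUP j\<in>B. b j) \<le> (SUP (i, j)\<in>A \<times> B. a i * b j)" .
qed

lemma sup_within_le: "sup_within A Ka f K x \<le> (SUP \<alpha>\<in>A. ennreal (f \<alpha> x))"
  unfolding sup_within_def by (rule SUP_subset_mono) auto

lemma measurable_sup_within:
  assumes "countable A" and "\<And>\<alpha>. \<alpha> \<in> A \<Longrightarrow> f \<alpha> \<in> borel_measurable N"
  shows "sup_within A Ka f K \<in> borel_measurable N"
  unfolding sup_within_def
proof (rule borel_measurable_SUP)
  show "countable {\<alpha> \<in> A. Ka \<alpha> \<subseteq> K}"
    by (rule countable_subset[OF _ assms(1)]) auto
  show "(\<lambda>x. ennreal (f \<alpha> x)) \<in> borel_measurable N" if "\<alpha> \<in> {\<alpha> \<in> A. Ka \<alpha> \<subseteq> K}" for \<alpha>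
    using assms(2)[of \<alpha>] that by simp
qed

lemma sup_within_cong:
  assumes dep: "\<And>\<alpha>. \<alpha> \<in> A \<Longrightarrow> depends_on N (f \<alpha>) (Ka \<alpha>)"
    and xy: "x \<in> space N" "y \<in> space N" "restrict x K = restrict y K"
  shows "sup_within A Ka f K x = sup_within A Ka f K y"
  unfolding sup_within_def
proof (rule SUP_cong[OF refl])
  fix \<alpha> assume \<alpha>: "\<alpha> \<in> {\<alpha> \<in> A. Ka \<alpha> \<subseteq> K}"
  have "restrict x (Ka \<alpha>) = restrict (restrict x K) (Ka \<alpha>)"
    using \<alpha> by (auto simp: restrict_def fun_eq_iff)
  also have "\<dots> = restrict y (Ka \<alpha>)"
    unfolding xy(3) using \<alpha> by (auto simp: restrict_def fun_eq_iff)
  finally have "f \<alpha> x = f \<alpha> y"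
    using dep[of \<alpha>] \<alpha> xy(1,2) unfolding depends_on_def by blast
  then show "ennreal (f \<alpha> x) = ennreal (f \<alpha> y)" by simp
qed

section \<open>The three inequalities\<close>

theorem proposition1p2:
  fixes n :: nat
    and M :: "nat \<Rightarrow> 'a measure"
    and S P :: "(nat \<Rightarrow> 'a) measure"
    and \<Omega> :: "'w measure"
    and X Y :: "'w \<Rightarrow> nat \<Rightarrow> 'a"
  assumes "n \<ge> 1"
    and "S = PiM {1..n} M"
    and "prob_space \<Omega>"
    and "X \<in> measurable \<Omega> S" and "Y \<in> measurable \<Omega> S"
    and "distr \<Omega> S X = P" and "distr \<Omega> S Y = P"
    and "prob_space.indep_vars \<Omega> M (\<lambda>i \<omega>. X \<omega> i) {1..n}"
    and "prob_space.indep_var \<Omega> S X S Y"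
  shows
    "(\<forall>(A :: 'i set) (B :: 'j set) f g Ka Lb.
        countable A \<and> countable B \<and>
        (\<forall>\<alpha>\<in>A. f \<alpha> \<in> borel_measurable S \<and> (\<forall>x\<in>space S. 0 \<le> f \<alpha> x) \<and>
               Ka \<alpha> \<subseteq> {1..n} \<and> depends_on S (f \<alpha>) (Ka \<alpha>)) \<and>
        (\<forall>\<beta>\<in>B. g \<beta> \<in> borel_measurable S \<and> (\<forall>x\<in>space S. 0 \<le> g \<beta> x) \<and>
               Lb \<beta> \<subseteq> {1..n} \<and> depends_on S (g \<beta>) (Lb \<beta>)) \<longrightarrow>
        (\<integral>\<^sup>+\<omega>. (SUP (K, L)\<in>{(K, L). K \<in> Ka ` A \<and> L \<in> Lb ` B \<and> K \<inter> L = {}}.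
                sup_within A Ka f K (X \<omega>) * sup_within B Lb g L (Y \<omega>)) \<partial>\<Omega>)
          \<le> (\<integral>\<^sup>+\<omega>. (SUP (\<alpha>, \<beta>)\<in>A \<times> B. ennreal (f \<alpha> (X \<omega>) * g \<beta> (X \<omega>))) \<partial>\<Omega>) \<and>
        (\<forall>K L.
           (\<lambda>(x, y). K x y) \<in> measurable (S \<Otimes>\<^sub>M S) (count_space (Pow {1..n})) \<and>
           (\<lambda>(x, y). L x y) \<in> measurable (S \<Otimes>\<^sub>M S) (count_space (Pow {1..n})) \<and>
           (\<forall>x\<in>space S. \<forall>y\<in>space S.
              K x y \<in> Ka ` A \<and> L x y \<in> Lb ` B \<and> K x y \<inter> L x y = {}) \<longrightarrow>
           (\<integral>\<^sup>+\<omega>. sup_within A Ka f (K (X \<omega>) (Y \<omega>)) (X \<omega>) *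
                 sup_within B Lb g (L (X \<omega>) (Y \<omega>)) (Y \<omega>) \<partial>\<Omega>)
             \<le> (\<integral>\<^sup>+\<omega>. (SUP (\<alpha>, \<beta>)\<in>A \<times> B. ennreal (f \<alpha> (X \<omega>) * g \<beta> (X \<omega>))) \<partial>\<Omega>)))
     \<and>
     (\<forall>f g \<K> \<L> K L.
        f \<in> borel_measurable S \<and> (\<forall>x\<in>space S. 0 \<le> f x) \<and>
        g \<in> borel_measurable S \<and> (\<forall>x\<in>space S. 0 \<le> g x) \<and>
        \<K> \<subseteq> Pow {1..n} \<and> \<L> \<subseteq> Pow {1..n} \<and>
        (\<lambda>(x, y). K x y) \<in> measurable (S \<Otimes>\<^sub>M S) (count_space (Pow {1..n})) \<and>
        (\<lambda>(x, y). L x y) \<in> measurable (S \<Otimes>\<^sub>M S) (count_space (Pow {1..n})) \<and>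
        (\<forall>x\<in>space S. \<forall>y\<in>space S.
           K x y \<in> \<K> \<and> L x y \<in> \<L> \<and> K x y \<inter> L x y = {}) \<longrightarrow>
        (\<integral>\<^sup>+\<omega>. ess_inf_fix n M P f (K (X \<omega>) (Y \<omega>)) (X \<omega>) *
              ess_inf_fix n M P g (L (X \<omega>) (Y \<omega>)) (Y \<omega>) \<partial>\<Omega>)
          \<le> (\<integral>\<^sup>+\<omega>. ennreal (f (X \<omega>) * g (X \<omega>)) \<partial>\<Omega>))"
proof -
  interpret \<Omega>: prob_space \<Omega> by fact
  let ?I = "{1..n}"
  note S = assms(2)
  note X [measurable] = assms(4) and Y [measurable] = assms(5)
  \<comment> \<open>Off \<open>{1..n}\<close> nothing is known about \<open>M i\<close>, which may even be empty; a point mass makes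
    every factor a probability space.\<close>
  define \<mu> where "\<mu> i = (if i \<in> ?I then distr \<Omega> (M i) (\<lambda>\<omega>. X \<omega> i)
    else return (count_space UNIV) undefined)" for i
  have X_i: "(\<lambda>\<omega>. X \<omega> i) \<in> measurable \<Omega> (M i)" if "i \<in> ?I" for i
    using measurable_compose[OF X[unfolded S] measurable_component_singleton[OF that]] .
  have prob_\<mu>: "prob_space (\<mu> i)" for i
    unfolding \<mu>_def using X_i by (auto intro!: \<Omega>.prob_space_distr prob_space_return)
  interpret finite_product_prob_space \<mu> ?I
  proof -
    interpret product_prob_space \<mu> ?I by (rule product_prob_spaceI) (rule prob_\<mu>)
    show "finite_product_prob_space \<mu> ?I" by unfold_locales simp
  qed
  have P_eq: "P = PiM ?I \<mu>"
  proof -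
    have "distr \<Omega> (PiM ?I M) (\<lambda>\<omega>. \<lambda>i\<in>?I. X \<omega> i) = PiM ?I (\<lambda>i. distr \<Omega> (M i) (\<lambda>\<omega>. X \<omega> i))"
      using \<Omega>.indep_vars_iff_distr_eq_PiM'[of ?I "\<lambda>i \<omega>. X \<omega> i" M] assms(1,8) X_i by auto
    also have "\<dots> = PiM ?I \<mu>" by (rule PiM_cong) (simp_all add: \<mu>_def)
    also have "distr \<Omega> (PiM ?I M) (\<lambda>\<omega>. \<lambda>i\<in>?I. X \<omega> i) = distr \<Omega> S X"
    proof (rule distr_cong)
      fix \<omega> assume "\<omega> \<in> space \<Omega>"
      then have "X \<omega> \<in> space (PiM ?I M)" using measurable_space[OF X] S by simp
      then show "(\<lambda>i\<in>?I. X \<omega> i) = X \<omega>" by (auto simp: space_PiM PiE_iff extensional_def)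
    qed (simp_all add: S)
    finally show ?thesis using assms(6) by simp
  qed
  have sets_P [measurable_cong]: "sets (PiM ?I \<mu>) = sets S"
    unfolding S by (rule sets_PiM_cong) (simp_all add: \<mu>_def)
  then have space_P: "space (PiM ?I \<mu>) = space S" by (rule sets_eq_imp_space_eq)
  have meas: "measurable (PiM ?I \<mu>) N = measurable S N" for N
    by (rule measurable_cong_sets[OF sets_P refl])
  have meas2: "measurable (PiM ?I \<mu> \<Otimes>\<^sub>M PiM ?I \<mu>) N = measurable (S \<Otimes>\<^sub>M S) N" for N
    by (rule measurable_cong_sets[OF sets_pair_measure_cong[OF sets_P sets_P] refl])
  have joint: "(\<integral>\<^sup>+\<omega>. H (X \<omega>, Y \<omega>) \<partial>\<Omega>) = (\<integral>\<^sup>+p. H p \<partial>(PiM ?I \<mu> \<Otimes>\<^sub>M PiM ?I \<mu>))"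
    if H: "H \<in> borel_measurable (S \<Otimes>\<^sub>M S)" for H
  proof -
    have "PiM ?I \<mu> \<Otimes>\<^sub>M PiM ?I \<mu> = distr \<Omega> (S \<Otimes>\<^sub>M S) (\<lambda>\<omega>. (X \<omega>, Y \<omega>))"
      using assms(9) assms(6,7) unfolding \<Omega>.indep_var_distribution_eq P_eq by simp
    then show ?thesis using H by (simp add: nn_integral_distr)
  qed
  have single: "(\<integral>\<^sup>+\<omega>. F (X \<omega>) \<partial>\<Omega>) = (\<integral>\<^sup>+x. F x \<partial>PiM ?I \<mu>)"
    if F: "F \<in> borel_measurable S" for F
    unfolding P_eq[symmetric] assms(6)[symmetric] using F by (simp add: nn_integral_distr)
  have selected: "(\<integral>\<^sup>+\<omega>. \<phi> (K (X \<omega>) (Y \<omega>)) (X \<omega>) * \<gamma> (L (X \<omega>) (Y \<omega>)) (Y \<omega>) \<partial>\<Omega>)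
      \<le> (\<integral>\<^sup>+\<omega>. F (X \<omega>) * G (X \<omega>) \<partial>\<Omega>)"
    if KL: "(\<lambda>(x, y). K x y) \<in> measurable (S \<Otimes>\<^sub>M S) (count_space (Pow ?I))"
        "(\<lambda>(x, y). L x y) \<in> measurable (S \<Otimes>\<^sub>M S) (count_space (Pow ?I))"
        "\<And>x y. x \<in> space S \<Longrightarrow> y \<in> space S \<Longrightarrow> K x y \<inter> L x y = {}"
      and FG: "F \<in> borel_measurable S" "G \<in> borel_measurable S"
      and \<phi>: "\<And>K. K \<subseteq> ?I \<Longrightarrow> \<phi> K \<in> borel_measurable S"
        "\<And>K x y. K \<subseteq> ?I \<Longrightarrow> x \<in> space S \<Longrightarrow> y \<in> space S \<Longrightarrow> restrict x K = restrict y K \<Longrightarrow> \<phi> K x = \<phi> K y"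
        "\<And>K. K \<subseteq> ?I \<Longrightarrow> AE x in PiM ?I \<mu>. \<phi> K x \<le> F x"
      and \<gamma>: "\<And>K. K \<subseteq> ?I \<Longrightarrow> \<gamma> K \<in> borel_measurable S"
        "\<And>K x y. K \<subseteq> ?I \<Longrightarrow> x \<in> space S \<Longrightarrow> y \<in> space S \<Longrightarrow> restrict x K = restrict y K \<Longrightarrow> \<gamma> K x = \<gamma> K y"
        "\<And>K. K \<subseteq> ?I \<Longrightarrow> AE x in PiM ?I \<mu>. \<gamma> K x \<le> G x"
    for K L F G \<phi> \<gamma>
  proof -
    let ?H = "\<lambda>p. \<phi> (case p of (x, y) \<Rightarrow> K x y) (fst p) * \<gamma> (case p of (x, y) \<Rightarrow> L x y) (snd p)"
    have H: "?H \<in> borel_measurable (S \<Otimes>\<^sub>M S)"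
      by (rule measurable_selected_product[OF _ KL(1,2) \<phi>(1) \<gamma>(1)]) simp_all
    have disj: "(case (x, y) of (x, y) \<Rightarrow> K x y) \<inter> (case (x, y) of (x, y) \<Rightarrow> L x y) = {}"
      if "x \<in> space S" "y \<in> space S" for x y
      using KL(3)[OF that] by simp
    from joint[OF H] have "(\<integral>\<^sup>+\<omega>. \<phi> (K (X \<omega>) (Y \<omega>)) (X \<omega>) * \<gamma> (L (X \<omega>) (Y \<omega>)) (Y \<omega>) \<partial>\<Omega>)
        = (\<integral>\<^sup>+p. ?H p \<partial>(PiM ?I \<mu> \<Otimes>\<^sub>M PiM ?I \<mu>))" by simp
    also have "\<dots> \<le> (\<integral>\<^sup>+x. F x * G x \<partial>PiM ?I \<mu>)"
      by (rule dual_reimer_selected[unfolded meas meas2 space_P])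
        (fact KL disj FG \<phi> \<gamma>)+
    also have "\<dots> = (\<integral>\<^sup>+\<omega>. F (X \<omega>) * G (X \<omega>) \<partial>\<Omega>)"
      by (rule single[symmetric]) (intro borel_measurable_times_ennreal FG)
    finally show ?thesis .
  qed
  show ?thesis
  proof (rule conjI, goal_cases)
    case 1
    show ?case
    proof (intro allI impI, elim conjE, goal_cases)
      case prems: (1 A B f g Ka Lb)
      have Ka: "Ka \<alpha> \<subseteq> ?I" if "\<alpha> \<in> A" for \<alpha> using prems(3) that by simp
      have Lb: "Lb \<beta> \<subseteq> ?I" if "\<beta> \<in> B" for \<beta> using prems(4) that by simp
      let ?F = "\<lambda>x. SUP \<alpha>\<in>A. ennreal (f \<alpha> x)" and ?G = "\<lambda>x. SUP \<beta>\<in>B. ennreal (g \<beta> x)"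
      let ?\<phi> = "sup_within A Ka f" and ?\<gamma> = "sup_within B Lb g"
      have FG: "?F \<in> borel_measurable S" "?G \<in> borel_measurable S"
        using prems(1-4) by (intro borel_measurable_SUP; simp)+
      have \<phi>: "?\<phi> K \<in> borel_measurable S"
        "\<And>x y. x \<in> space S \<Longrightarrow> y \<in> space S \<Longrightarrow> restrict x K = restrict y K \<Longrightarrow> ?\<phi> K x = ?\<phi> K y"
        "AE x in PiM ?I \<mu>. ?\<phi> K x \<le> ?F x" if "K \<subseteq> ?I" for K
      proof -
        show "?\<phi> K \<in> borel_measurable S"
          using prems(1,3) by (intro measurable_sup_within) simp_all
        show "?\<phi> K x = ?\<phi> K y" if "x \<in> space S" "y \<in> space S" "restrict x K = restrict y K" for x y
          using prems(3) by (intro sup_within_cong[OF _ that]) simp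
        show "AE x in PiM ?I \<mu>. ?\<phi> K x \<le> ?F x"
          by (intro AE_I2 sup_within_le)
      qed
      have \<gamma>: "?\<gamma> L \<in> borel_measurable S"
        "\<And>x y. x \<in> space S \<Longrightarrow> y \<in> space S \<Longrightarrow> restrict x L = restrict y L \<Longrightarrow> ?\<gamma> L x = ?\<gamma> L y"
        "AE x in PiM ?I \<mu>. ?\<gamma> L x \<le> ?G x" if "L \<subseteq> ?I" for L
      proof -
        show "?\<gamma> L \<in> borel_measurable S"
          using prems(2,4) by (intro measurable_sup_within) simp_all
        show "?\<gamma> L x = ?\<gamma> L y" if "x \<in> space S" "y \<in> space S" "restrict x L = restrict y L" for x y
          using prems(4) by (intro sup_within_cong[OF _ that]) simp
        show "AE x in PiM ?I \<mu>. ?\<gamma> L x \<le> ?G x"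
          by (intro AE_I2 sup_within_le)
      qed
      have rhs: "(\<integral>\<^sup>+\<omega>. (SUP (\<alpha>, \<beta>)\<in>A \<times> B. ennreal (f \<alpha> (X \<omega>) * g \<beta> (X \<omega>))) \<partial>\<Omega>)
          = (\<integral>\<^sup>+\<omega>. ?F (X \<omega>) * ?G (X \<omega>) \<partial>\<Omega>)"
      proof (rule nn_integral_cong)
        fix \<omega> assume "\<omega> \<in> space \<Omega>"
        then have "X \<omega> \<in> space S" by (rule measurable_space[OF X])
        then have "(SUP (\<alpha>, \<beta>)\<in>A \<times> B. ennreal (f \<alpha> (X \<omega>) * g \<beta> (X \<omega>)))
            = (SUP (\<alpha>, \<beta>)\<in>A \<times> B. ennreal (f \<alpha> (X \<omega>)) * ennreal (g \<beta> (X \<omega>)))"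
          using prems(3,4) by (intro SUP_cong) (auto simp: ennreal_mult)
        then show "(SUP (\<alpha>, \<beta>)\<in>A \<times> B. ennreal (f \<alpha> (X \<omega>) * g \<beta> (X \<omega>))) = ?F (X \<omega>) * ?G (X \<omega>)"
          by (simp only: SUP_times_ennreal)
      qed
      show ?case
        unfolding rhs
      proof (rule conjI, goal_cases)
        case 1
        \<comment> \<open>The maximum is over finitely many pairs, so it is attained at a pair of disjoint sets
          for each \<open>(x, y)\<close>; an empty maximum is 0 and is covered by the pair of empty sets.\<close>
        define T where "T = {(K, L). K \<in> Ka ` A \<and> L \<in> Lb ` B \<and> K \<inter> L = {}}"
        let ?H = "\<lambda>p. SUP (K, L)\<in>T. ?\<phi> K (fst p) * ?\<gamma> L (snd p)"
        have T: "K \<subseteq> ?I \<and> L \<subseteq> ?I \<and> K \<inter> L = {}" if "(K, L) \<in> T" for K L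
          using that Ka Lb unfolding T_def by blast
        then have "T \<subseteq> Pow ?I \<times> Pow ?I" by (intro subrelI) simp
        then have fin: "finite T" by (rule finite_subset) simp
        have H: "?H \<in> borel_measurable (S \<Otimes>\<^sub>M S)"
        proof (rule borel_measurable_SUP)
          show "countable T" using fin by (rule countable_finite)
          fix t assume "t \<in> T"
          obtain K L where t: "t = (K, L)" by (cases t)
          then have KL: "K \<subseteq> ?I" "L \<subseteq> ?I" using T[of K L] \<open>t \<in> T\<close> by simp_all
          show "(\<lambda>p. case t of (K, L) \<Rightarrow> ?\<phi> K (fst p) * ?\<gamma> L (snd p)) \<in> borel_measurable (S \<Otimes>\<^sub>M S)"
            unfolding t prod.case
            by (rule borel_measurable_times_ennreal)
              (rule measurable_compose[OF measurable_fst \<phi>(1)[OF KL(1)]]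
                measurable_compose[OF measurable_snd \<gamma>(1)[OF KL(2)]])+
        qed
        have attained: "\<exists>K L. K \<subseteq> ?I \<and> L \<subseteq> ?I \<and> K \<inter> L = {} \<and> ?H (x, y) \<le> ?\<phi> K x * ?\<gamma> L y"
          if "x \<in> space S" "y \<in> space S" for x y
        proof (cases "T = {}")
          case True
          then have "?H (x, y) \<le> ?\<phi> {} x * ?\<gamma> {} y" by (simp add: bot_ennreal)
          then show ?thesis by (intro exI[of _ "{}"]) simp
        next
          case False
          let ?V = "(\<lambda>(K, L). ?\<phi> K x * ?\<gamma> L y) ` T"
          have V: "finite ?V" "?V \<noteq> {}" using fin False by simp_all
          then have "Sup ?V \<in> ?V" unfolding Max_Sup[OF V, symmetric] by (rule Max_in)
          then obtain K L where "(K, L) \<in> T" "Sup ?V = ?\<phi> K x * ?\<gamma> L y" by auto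
          then show ?thesis using T[of K L] by (intro exI[of _ K] exI[of _ L]) simp
        qed
        from joint[OF H] have "(\<integral>\<^sup>+\<omega>. (SUP (K, L)\<in>T. ?\<phi> K (X \<omega>) * ?\<gamma> L (Y \<omega>)) \<partial>\<Omega>)
            = (\<integral>\<^sup>+p. ?H p \<partial>(PiM ?I \<mu> \<Otimes>\<^sub>M PiM ?I \<mu>))" by simp
        also have "\<dots> \<le> (\<integral>\<^sup>+x. ?F x * ?G x \<partial>PiM ?I \<mu>)"
          by (rule dual_reimer_integral[where \<phi> = ?\<phi> and \<gamma> = ?\<gamma>, unfolded meas meas2 space_P])
            (fact H FG attained \<phi> \<gamma>)+
        also have "\<dots> = (\<integral>\<^sup>+\<omega>. ?F (X \<omega>) * ?G (X \<omega>) \<partial>\<Omega>)"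
          by (rule single[symmetric]) (rule borel_measurable_times_ennreal[OF FG])
        finally show ?case unfolding T_def .
      next
        case 2
        show ?case
        proof (intro allI impI, elim conjE, goal_cases)
          case KL: (1 K L)
          then have disj: "K x y \<inter> L x y = {}" if "x \<in> space S" "y \<in> space S" for x y
            using that by simp
          show ?case
            by (rule selected[OF KL(1,2) _ FG]) (fact disj \<phi> \<gamma>)+
        qed
      qed
    qed
  next
    case 2
    show ?case
    proof (intro allI impI, elim conjE, goal_cases)
      case prems: (1 f g \<K> \<L> K L)
      let ?F = "\<lambda>x. ennreal (f x)" and ?G = "\<lambda>x. ennreal (g x)"
      have FG: "?F \<in> borel_measurable S" "?G \<in> borel_measurable S"
        using prems(1,3) by simp_all
      have fix_eq: "ess_inf_fix n M P h K = fibre_ess_inf (\<lambda>x. ennreal (h x)) K" for h K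
      proof -
        have "marginal M P (?I - K) = distr (PiM ?I \<mu>) (PiM (?I - K) \<mu>) (\<lambda>z. restrict z (?I - K))"
          unfolding marginal_def P_eq by (rule distr_cong) (auto intro!: sets_PiM_cong simp: \<mu>_def)
        also have "\<dots> = PiM (?I - K) \<mu>" by (rule distr_restrict[symmetric]) auto
        finally show ?thesis by (intro ext) (simp only: ess_inf_fix_def fibre_ess_inf_def)
      qed
      have ess: "fibre_ess_inf H K \<in> borel_measurable S"
        "AE x in PiM ?I \<mu>. fibre_ess_inf H K x \<le> H x"
        if "H \<in> borel_measurable S" "K \<subseteq> ?I" for H K
        by (rule measurable_fibre_ess_inf[unfolded meas, OF that] AE_fibre_ess_inf_le[unfolded meas, OF that])+
      have disj: "K x y \<inter> L x y = {}" if "x \<in> space S" "y \<in> space S" for x y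
        using prems(9) that by simp
      have dep: "fibre_ess_inf H K x = fibre_ess_inf H K y"
        if "K \<subseteq> ?I" "x \<in> space S" "y \<in> space S" "restrict x K = restrict y K" for H K x y
        using that(4) by (rule fibre_ess_inf_cong)
      have "(\<integral>\<^sup>+\<omega>. ess_inf_fix n M P f (K (X \<omega>) (Y \<omega>)) (X \<omega>) *
                ess_inf_fix n M P g (L (X \<omega>) (Y \<omega>)) (Y \<omega>) \<partial>\<Omega>)
          \<le> (\<integral>\<^sup>+\<omega>. ?F (X \<omega>) * ?G (X \<omega>) \<partial>\<Omega>)"
        unfolding fix_eq
        by (rule selected[OF prems(7,8) _ FG])
          (fact disj dep ess[OF FG(1)] ess[OF FG(2)])+
      also have "\<dots> = (\<integral>\<^sup>+\<omega>. ennreal (f (X \<omega>) * g (X \<omega>)) \<partial>\<Omega>)"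
        using prems(2,4) measurable_space[OF X] by (intro nn_integral_cong) (simp add: ennreal_mult)
      finally show ?case .
    qed
  qed
qed

end
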